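(* Let $q,\tilde q\in L^1([0,\pi];\mathbb{C})$, let $r\in[0,\pi)$ and $x_0\in(r,\pi]$, and assume that $q,\tilde q\in C^m[x_0-\delta,x_0]$ for some sufficiently small $\delta>0$ and some $m\in\mathbb{N}_0$. If $q_-^{(j)}(x_0)=\tilde q_-^{(j)}(x_0)$ for $j=0,1,\dots,m$, then for every $\zeta>0$, as $|\lambda|\to\infty$ in the sector $\Lambda_\zeta=\{\lambda\in\mathbb{C}:\zeta<\operatorname{Arg}(\lambda)<\pi-\zeta\}$, $$y_{1,r}(x_0,\lambda)\tilde y_{1,r}'(x_0,\lambda)-y_{1,r}'(x_0,\lambda)\tilde y_{1,r}(x_0,\lambda)=o\left(\frac{\exp(2|\operatorname{Im}\sqrt\lambda|(x_0-r))}{|\sqrt\lambda|^{m+1}}\right),$$ $$y_{1,r}(x_0,\lambda)\tilde y_{2,r}'(x_0,\lambda)-y_{1,r}'(x_0,\lambda)\tilde y_{2,r}(x_0,\lambda)=o\left(\frac{\exp(2|\operatorname{Im}\sqrt\lambda|(x_0-r))}{|\sqrt\lambda|^{m+2}}\right),$$ $$\tilde y_{1,r}'(x_0,\lambda)y_{2,r}(x_0,\lambda)-\tilde y_{1,r}(x_0,\lambda)y_{2,r}'(x_0,\lambda)=o\left(\frac{\exp(2|\operatorname{Im}\sqrt\lambda|(x_0-r))}{|\sqrt\lambda|^{m+2}}\right),$$ $$y_{2,r}(x_0,\lambda)\tilde y_{2,r}'(x_0,\lambda)-y_{2,r}'(x_0,\lambda)\tilde y_{2,r}(x_0,\lamb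da)=o\left(\frac{\exp(2|\operatorname{Im}\sqrt\lambda|(x_0-r))}{|\sqrt\lambda|^{m+3}}\right).$$
   Context: For $r\in[0,\pi)$ and $i=1,2$, $y_{i,r}(x,\lambda)$ and $\tilde y_{i,r}(x,\lambda)$ are the solutions of $-y''+q(x)y=\lambda y$ and $-y''+\tilde q(x)y=\lambda y$, respectively (with no jump conditions), satisfying the initial conditions $y_{1,r}(r,\lambda)=y_{2,r}'(r,\lambda)=1$, $y_{2,r}(r,\lambda)=y_{1,r}'(r,\lambda)=0$ and $\tilde y_{1,r}(r,\lambda)=\tilde y_{2,r}'(r,\lambda)=1$, $\tilde y_{2,r}(r,\lambda)=\tilde y_{1,r}'(r,\lambda)=0$; primes denote $d/dx$. For $f\in C^m[x_0-\delta,x_0]$, $f_-^{(j)}(x_0)$ denotes the $j$-th left derivative at $x_0$, with $f_-^{(0)}(x_0)=f(x_0)$. *)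

theory Defs
  imports "HOL-Analysis.Analysis"
begin

(* Absolute continuity of a function (epsilon-delta form); each k in the division is a
   compact interval with end points Inf k and Sup k, and the division need not cover S. *)
definition absolutely_continuous_on :: "real set \<Rightarrow> (real \<Rightarrow> complex) \<Rightarrow> bool" where
  "absolutely_continuous_on S f \<longleftrightarrow>
     (\<forall>\<epsilon>>0. \<exists>\<delta>>0. \<forall>D T. D division_of T \<and> T \<subseteq> S \<and> (\<Sum>k\<in>D. Sup k - Inf k) < \<delta> \<longrightarrow>
        (\<Sum>k\<in>D. norm (f (Sup k) - f (Inf k))) < \<epsilon>)"

(* The derivative on [0, pi] is one-sided at the two end points. *)
definition ddx :: "(real \<Rightarrow> complex) \<Rightarrow> real \<Rightarrow> complex" where
  "ddx y x = vector_derivative y (at x within {0..pi})"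

(* Solution of -y'' + q y = z y on [0, pi] in the Caratheodory sense, as is needed for q in L^1:
   y is differentiable, y' is absolutely continuous (so y is C^1), and the equation holds
   almost everywhere. *)
definition SL_solution :: "(real \<Rightarrow> complex) \<Rightarrow> complex \<Rightarrow> (real \<Rightarrow> complex) \<Rightarrow> bool" where
  "SL_solution q z y \<longleftrightarrow>
     y differentiable_on {0..pi} \<and>
     absolutely_continuous_on {0..pi} (ddx y) \<and>
     (AE x in lebesgue. x \<in> {0..pi} \<longrightarrow>
        (\<exists>y''. (ddx y has_vector_derivative y'') (at x within {0..pi}) \<and>
               - y'' + q x * y x = z * y x))"

primrec nth_deriv_within :: "real set \<Rightarrow> nat \<Rightarrow> (real \<Rightarrow> complex) \<Rightarrow> real \<Rightarrow> complex" where
  "nth_deriv_within S 0 f = f"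
| "nth_deriv_within S (Suc j) f =
     (\<lambda>x. vector_derivative (nth_deriv_within S j f) (at x within S))"

definition C_m_on :: "nat \<Rightarrow> real set \<Rightarrow> (real \<Rightarrow> complex) \<Rightarrow> bool" where
  "C_m_on m S f \<longleftrightarrow>
     (\<forall>j<m. nth_deriv_within S j f differentiable_on S) \<and>
     (\<forall>j\<le>m. continuous_on S (nth_deriv_within S j f))"

primrec left_deriv :: "nat \<Rightarrow> (real \<Rightarrow> complex) \<Rightarrow> real \<Rightarrow> complex" where
  "left_deriv 0 f = f"
| "left_deriv (Suc j) f = (\<lambda>x. vector_derivative (left_deriv j f) (at_left x))"

definition sector :: "real \<Rightarrow> complex set" where
  "sector \<zeta> = {z. \<zeta> < Arg z \<and> Arg z < pi - \<zeta>}"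

definition infinity_in_sector :: "real \<Rightarrow> complex filter" where
  "infinity_in_sector \<zeta> = inf at_infinity (principal (sector \<zeta>))"

(* The choice of the branch of the square root is immaterial here: only moduli of
   csqrt z and of its imaginary part occur. *)
definition bound :: "real \<Rightarrow> nat \<Rightarrow> complex \<Rightarrow> complex" where
  "bound l n z = of_real (exp (2 * \<bar>Im (csqrt z)\<bar> * l) / norm (csqrt z) ^ n)"

end

theory Submission
  imports Defs
begin

text \<open>The Wronskian \<open>W = y yt' - y' yt\<close> satisfies \<open>W' = (qt - q) y yt\<close> almost everywhere, so
  \<open>W(x\<^sub>0) - W(r)\<close> is the integral of \<open>(qt - q) y yt\<close> over \<open>[r, x\<^sub>0]\<close>. For large \<open>k = csqrt z\<close>
  the solutions at \<open>x\<close> are at most \<open>2 exp (Im k (x - r))\<close> in modulus, with a further factor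
  \<open>1 / |k|\<close> for those that vanish at \<open>r\<close>. By Taylor's theorem \<open>q - qt = o((x\<^sub>0 - x)^m)\<close> at \<open>x\<^sub>0\<close>,
  and integrating this against \<open>exp (2 Im k (x - r))\<close> gains a factor \<open>1 / (Im k)^(m + 1)\<close>, while
  the part of the integral away from \<open>x\<^sub>0\<close> and the constant \<open>W(r)\<close> are exponentially smaller.
  In the sector, \<open>Im k\<close> is comparable to \<open>|k|\<close>.\<close>

section \<open>Absolutely continuous functions\<close>

text \<open>Two members of a division meet in a convex set with empty interior, which is null, so
  the lengths add up to the measure of the union. This turns an open set of small measure into the
  small total length that absolute continuity asks for.\<close>

lemma sum_interval_length_le_measure:
  fixes D :: "real set set"
  assumes "D division_of T" "T \<subseteq> U" "U \<in> lmeasurable"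
  shows "(\<Sum>k\<in>D. Sup k - Inf k) \<le> measure lebesgue U"
proof -
  have cb: "\<exists>a b. k = cbox a b \<and> a \<le> b" if "k \<in> D" for k
    using division_ofD[OF assms(1)] that by (metis box_real(2) atLeastatMost_empty linorder_not_less)
  have fin: "finite D" and T: "\<Union>D = T" using assms(1) by auto
  have "(\<Sum>k\<in>D. Sup k - Inf k) = (\<Sum>k\<in>D. measure lebesgue k)"
    by (rule sum.cong[OF refl]) (use cb in fastforce)
  also have "\<dots> = measure lebesgue (\<Union>D)"
  proof (rule measure_negligible_finite_Union[symmetric, OF fin])
    show "k \<in> lmeasurable" if "k \<in> D" for k using cb[OF that] by auto
    show "pairwise (\<lambda>S T. negligible (S \<inter> T)) D"
    proof (rule pairwiseI)
      fix k l assume kl: "k \<in> D" "l \<in> D" "k \<noteq> l"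
      obtain a b c d where ab: "k = cbox a b" "l = cbox c d" using cb kl by blast
      have "interior k \<inter> interior l = {}" using division_ofD(5)[OF assms(1)] kl by blast
      then have "interior (k \<inter> l) = {}" by simp
      then show "negligible (k \<inter> l)"
        by (simp add: ab negligible_convex_interior convex_Int)
    qed
  qed
  also have "\<dots> \<le> measure lebesgue U"
  proof (rule measure_mono_fmeasurable)
    show "\<Union>D \<subseteq> U" using T assms(2) by simp
    have "D \<subseteq> sets lebesgue" using cb by fastforce
    then show "\<Union>D \<in> sets lebesgue" using fin by (rule sets.finite_Union[rotated])
  qed (rule assms(3))
  finally show ?thesis .
qed

text \<open>Tags in the exceptional null set are controlled by absolute continuity: their intervals
  lie in an open cover of small measure.\<close>

lemma has_integral_absolutely_continuous_on:
  fixes F f :: "real \<Rightarrow> complex"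
  assumes ab: "a \<le> b" and AC: "absolutely_continuous_on {a..b} F" and N: "negligible N"
    and der: "\<And>x. x \<in> {a..b} - N \<Longrightarrow> (F has_vector_derivative f x) (at x within {a..b})"
  shows "(f has_integral (F b - F a)) {a..b}"
proof (rule has_integral_spike[OF N])
  \<comment> \<open>Nothing is known about \<open>f\<close> on \<open>N\<close>; with the value 0
    there, a tag in \<open>N\<close> contributes nothing to a Riemann sum.\<close>
  define f0 where "f0 x = (if x \<in> N then 0 else f x)" for x
  show "f x = f0 x" if "x \<in> {a..b} - N" for x using that by (simp add: f0_def)
  show "(f0 has_integral (F b - F a)) {a..b}"
    unfolding has_integral_real
  proof (intro allI impI)
    fix e :: real assume "e > 0"
    \<comment> \<open>The summand 1 keeps the denominator positive for \<open>a = b\<close> and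
      makes \<open>c * (b - a) < e / 2\<close> strict.\<close>
    define c where "c = e / (2 * (b - a + 1))"
    have c: "c > 0" "c * (b - a) < e / 2" using \<open>e > 0\<close> ab by (auto simp: c_def field_simps)
    obtain \<delta> where "\<delta> > 0" and \<delta>: "\<And>D T. D division_of T \<Longrightarrow> T \<subseteq> {a..b} \<Longrightarrow>
        (\<Sum>k\<in>D. Sup k - Inf k) < \<delta> \<Longrightarrow> (\<Sum>k\<in>D. norm (F (Sup k) - F (Inf k))) < e / 2"
      using AC[unfolded absolutely_continuous_on_def, rule_format, OF half_gt_zero[OF \<open>e > 0\<close>]] by blast
    obtain U where U: "open U" "N \<subseteq> U" "U \<in> lmeasurable" "measure lebesgue U < \<delta>"
    proof -
      have N0: "N \<in> null_sets lebesgue" using N by (simp add: negligible_iff_null_sets)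
      then obtain U where U: "open U" "N \<subseteq> U" "U - N \<in> lmeasurable"
          "emeasure lebesgue (U - N) < ennreal \<delta>"
        using sets_lebesgue_outer_open[of N \<delta>] \<open>\<delta> > 0\<close> by blast
      have Un: "U = (U - N) \<union> N" using U by blast
      have Um: "U \<in> lmeasurable"
        by (subst Un, rule fmeasurable.Un[OF U(3)]) (use N in \<open>simp add: negligible_imp_measurable\<close>)
      have "emeasure lebesgue U = emeasure lebesgue (U - N)"
        by (rule emeasure_Diff_null_set[OF N0, symmetric]) (use Um in blast)
      then have "ennreal (measure lebesgue U) < ennreal \<delta>"
        using U(4) emeasure_eq_measure2[OF Um] by simp
      then have "measure lebesgue U < \<delta>"
        by (simp add: ennreal_less_iff)
      then show thesis using that U Um by blast
    qed
    \<comment> \<open>The radii of the gauge: off \<open>N\<close>, \<open>F\<close> is linear up to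
      an error of slope \<open>c\<close> within the radius; on \<open>N\<close>, the ball stays
      inside \<open>U\<close>.\<close>
    have "\<exists>d>0. (x \<in> {a..b} - N \<longrightarrow> (\<forall>y\<in>{a..b}. norm (y - x) < d \<longrightarrow>
            norm (F y - F x - (y - x) *\<^sub>R f x) \<le> c * norm (y - x)))
         \<and> (x \<in> N \<longrightarrow> ball x d \<subseteq> U)" for x
    proof (cases "x \<in> N")
      case True
      then obtain d where "d > 0" "ball x d \<subseteq> U" using U open_contains_ball by blast
      then show ?thesis using True by auto
    next
      case False
      show ?thesis
      proof (cases "x \<in> {a..b}")
        case True
        then obtain d where "d > 0" "\<forall>y\<in>{a..b}. norm (y - x) < d \<longrightarrow>
            norm (F y - F x - (y - x) *\<^sub>R f x) \<le> c * norm (y - x)"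
          using der[of x] False c(1) unfolding has_vector_derivative_def has_derivative_within_alt
          by blast
        then show ?thesis using False by auto
      qed (use False in \<open>auto intro: exI[of _ 1]\<close>)
    qed
    then obtain d where d0: "\<And>x. d x > 0"
      and d: "\<And>x y. \<lbrakk>x \<in> {a..b} - N; y \<in> {a..b}; norm (y - x) < d x\<rbrakk> \<Longrightarrow>
            norm (F y - F x - (y - x) *\<^sub>R f x) \<le> c * norm (y - x)"
      and dU: "\<And>x. x \<in> N \<Longrightarrow> ball x (d x) \<subseteq> U"
      by metis
    show "\<exists>\<gamma>. gauge \<gamma> \<and> (\<forall>\<D>. \<D> tagged_division_of {a..b} \<and> \<gamma> fine \<D> \<longrightarrow>
        norm ((\<Sum>(x,k)\<in>\<D>. measure lborel k *\<^sub>R f0 x) - (F b - F a)) < e)"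
    proof (rule exI, safe)
      show "gauge (\<lambda>x. ball x (d x))" using d0 gauge_ball_dependent by blast
    next
      fix p assume p: "p tagged_division_of {a..b}" and fine: "(\<lambda>x. ball x (d x)) fine p"
      define q where "q = {(x,k)\<in>p. x \<in> N}"
      define h where "h k = (if k = {} then 0 else norm (F (Sup k) - F (Inf k)))" for k
      have finp: "finite p" using p by auto
      have td: "x \<in> k" "k \<subseteq> {a..b}" "\<exists>u v. k = cbox u v \<and> u \<le> v" if "(x,k) \<in> p" for x k
      proof -
        note * = tagged_division_ofD(2-4)[OF p that]
        show "x \<in> k" "k \<subseteq> {a..b}" using * by blast+
        obtain u v where "k = cbox u v" using * by blast
        then show "\<exists>u v. k = cbox u v \<and> u \<le> v" using \<open>x \<in> k\<close> by fastforce
      qed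
      have qp: "q tagged_partial_division_of {a..b}"
        by (rule tagged_partial_division_subset[of p])
          (use p in \<open>simp_all add: q_def tagged_division_of_def subset_iff\<close>)
      have "(\<Sum>(x,k)\<in>q. h k) = sum h (snd ` q)"
        by (rule sum.over_tagged_division_lemma[OF tagged_partial_division_of_Union_self[OF qp]])
          (auto simp: h_def)
      also have "\<dots> = (\<Sum>k\<in>snd ` q. norm (F (Sup k) - F (Inf k)))"
      proof (rule sum.cong[OF refl])
        fix k assume "k \<in> snd ` q"
        then have "k \<noteq> {}" using td(1) unfolding q_def by fastforce
        then show "h k = norm (F (Sup k) - F (Inf k))" by (simp add: h_def)
      qed
      also have "\<dots> < e / 2"
      proof (rule \<delta>[OF partial_division_of_tagged_division[OF qp]])
        show "\<Union>(snd ` q) \<subseteq> {a..b}"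
        proof (rule Union_least, clarsimp simp: q_def)
          fix x k y assume "(x,k) \<in> p" "y \<in> k" then show "a \<le> y \<and> y \<le> b" using td(2)[of x k] by auto
        qed
        have "\<Union>(snd ` q) \<subseteq> U"
        proof (rule Union_least)
          fix k assume "k \<in> snd ` q"
          then obtain x where "(x,k) \<in> p" "x \<in> N" by (auto simp: q_def)
          then have "k \<subseteq> ball x (d x)" using fine by (auto simp: fine_def)
          then show "k \<subseteq> U" using dU[OF \<open>x \<in> N\<close>] by blast
        qed
        then show "(\<Sum>k\<in>snd ` q. Sup k - Inf k) < \<delta>"
          using sum_interval_length_le_measure[OF partial_division_of_tagged_division[OF qp] _ U(3)] U(4)
          by linarith
      qed
      finally have q_small: "(\<Sum>(x,k)\<in>q. h k) < e / 2" .
      \<comment> \<open>Both \<open>b - a\<close> and \<open>F b - F a\<close> telescope over the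
        tagged division, so the error can be estimated interval by interval.\<close>
      have tele: "b - a = (\<Sum>(x,K)\<in>p. Sup K - Inf K)" "F b - F a = (\<Sum>(x,K)\<in>p. F (Sup K) - F (Inf K))"
        using additive_tagged_division_1[OF ab p, of "\<lambda>x. x"] additive_tagged_division_1[OF ab p, of F]
        by auto
      have local: "norm (measure lborel k *\<^sub>R f0 x - (F (Sup k) - F (Inf k)))
          \<le> c * (Sup k - Inf k) + (if x \<in> N then h k else 0)" if xk: "(x,k) \<in> p" for x k
      proof -
        obtain u v where k: "k = {u..v}" "u \<le> v" using td(3)[OF xk] by auto
        have xuv: "u \<le> x" "x \<le> v" "a \<le> u" "v \<le> b" using td(1,2)[OF xk] k by auto
        show ?thesis
        proof (cases "x \<in> N")
          case True
          then show ?thesis using c(1) k by (simp add: f0_def h_def norm_minus_commute)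
        next
          case False
          have b: "k \<subseteq> ball x (d x)" using fine xk by (auto simp: fine_def)
          have uv: "u \<in> ball x (d x)" "v \<in> ball x (d x)" using b k by auto
          have A: "norm (F v - F x - (v - x) *\<^sub>R f x) \<le> c * (v - x)"
            using d[of x v] False xuv uv by (simp add: dist_real_def)
          have B: "norm (F u - F x - (u - x) *\<^sub>R f x) \<le> c * (x - u)"
            using d[of x u] False xuv uv by (simp add: dist_real_def)
          \<comment> \<open>Straddling: the increment over the interval is split at the tag
            \<open>x\<close>, and the two linearisation errors add up to
            \<open>c * (v - u)\<close>.\<close>
          have "(v - u) *\<^sub>R f x - (F v - F u)
              = (F u - F x - (u - x) *\<^sub>R f x) - (F v - F x - (v - x) *\<^sub>R f x)"
            by (simp add: algebra_simps)
          then have "norm ((v - u) *\<^sub>R f x - (F v - F u)) \<le> c * (x - u) + c * (v - x)"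
            by (metis A B norm_triangle_le_diff add_mono)
          then show ?thesis using False k by (simp add: f0_def algebra_simps)
        qed
      qed
      have "norm ((\<Sum>(x,k)\<in>p. measure lborel k *\<^sub>R f0 x) - (F b - F a))
          = norm (\<Sum>(x,k)\<in>p. measure lborel k *\<^sub>R f0 x - (F (Sup k) - F (Inf k)))"
        by (simp add: tele(2) split_def sum_subtractf)
      also have "\<dots> \<le> (\<Sum>(x,k)\<in>p. c * (Sup k - Inf k) + (if x \<in> N then h k else 0))"
        by (rule sum_norm_le) (use local in auto)
      also have "\<dots> = c * (b - a) + (\<Sum>(x,k)\<in>p. if x \<in> N then h k else 0)"
        by (simp add: tele(1) split_def sum.distrib sum_distrib_left)
      also have "(\<Sum>(x,k)\<in>p. if x \<in> N then h k else 0) = (\<Sum>(x,k)\<in>q. h k)"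
        unfolding q_def by (rule sum.mono_neutral_cong_right) (auto simp: finp split: if_splits)
      finally show "norm ((\<Sum>(x,k)\<in>p. measure lborel k *\<^sub>R f0 x) - (F b - F a)) < e"
        using q_small c(2) by linarith
    qed
  qed
qed

section \<open>Closure properties of absolute continuity\<close>

lemma division_interval_bounds:
  fixes k :: "real set"
  assumes "D division_of T" "T \<subseteq> {a..b}" "k \<in> D"
  shows "Sup k \<in> {a..b}" "Inf k \<in> {a..b}" "Inf k \<le> Sup k"
proof -
  obtain u v where k: "k = {u..v}" and ne: "k \<noteq> {}" and sub: "k \<subseteq> {a..b}"
    using division_ofD(2,3,4)[OF assms(1,3)] assms(2) by (metis box_real(2) subset_trans)
  have "u \<le> v" using k ne by simp
  then show "Sup k \<in> {a..b}" "Inf k \<in> {a..b}" "Inf k \<le> Sup k" using k sub by auto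
qed

lemma absolutely_continuous_on_subset:
  "absolutely_continuous_on S f \<Longrightarrow> T \<subseteq> S \<Longrightarrow> absolutely_continuous_on T f"
  unfolding absolutely_continuous_on_def by (meson subset_trans)

text \<open>A single interval is a division, so the definition specialises to uniform
  continuity.\<close>

lemma absolutely_continuous_on_imp_continuous_on:
  assumes "absolutely_continuous_on {a..b} f"
  shows "continuous_on {a..b} f"
proof -
  have "\<exists>d>0. \<forall>x'\<in>{a..b}. dist x' x < d \<longrightarrow> dist (f x') (f x) < e"
    if "x \<in> {a..b}" "e > 0" for x e
  proof -
    obtain d where "d > 0" and d: "\<And>D T. D division_of T \<Longrightarrow> T \<subseteq> {a..b} \<Longrightarrow>
        (\<Sum>k\<in>D. Sup k - Inf k) < d \<Longrightarrow> (\<Sum>k\<in>D. norm (f (Sup k) - f (Inf k))) < e"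
      using assms[unfolded absolutely_continuous_on_def, rule_format, OF \<open>e > 0\<close>] by blast
    have *: "dist (f u) (f v) < e" if "u \<le> v" "u \<in> {a..b}" "v \<in> {a..b}" "v - u < d" for u v
    proof -
      have "{{u..v}} division_of {u..v}"
        using division_of_self[of u v] that(1) by simp
      from d[OF this] show ?thesis using that by (simp add: dist_norm norm_minus_commute)
    qed
    have "dist (f x') (f x) < e" if "x' \<in> {a..b}" "dist x' x < d" for x'
      using *[of x' x] *[of x x'] that \<open>x \<in> {a..b}\<close>
      by (cases "x' \<le> x") (auto simp: dist_real_def dist_commute)
    then show ?thesis using \<open>d > 0\<close> by blast
  qed
  then show ?thesis unfolding continuous_on_iff by blast
qed

lemma absolutely_continuous_on_lipschitz:
  fixes f :: "real \<Rightarrow> complex"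
  assumes lip: "\<And>x y. \<lbrakk>x \<in> {a..b}; y \<in> {a..b}\<rbrakk> \<Longrightarrow> norm (f x - f y) \<le> B * \<bar>x - y\<bar>"
  shows "absolutely_continuous_on {a..b} f"
  unfolding absolutely_continuous_on_def
proof (intro allI impI)
  fix e :: real assume "e > 0"
  show "\<exists>\<delta>>0. \<forall>D T. D division_of T \<and> T \<subseteq> {a..b} \<and> (\<Sum>k\<in>D. Sup k - Inf k) < \<delta> \<longrightarrow>
      (\<Sum>k\<in>D. norm (f (Sup k) - f (Inf k))) < e"
  proof (intro exI[of _ "e / (\<bar>B\<bar> + 1)"] conjI allI impI; (elim conjE)?)
    fix D T assume D: "D division_of T" "T \<subseteq> {a..b}" "(\<Sum>k\<in>D. Sup k - Inf k) < e / (\<bar>B\<bar> + 1)"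
    have "(\<Sum>k\<in>D. norm (f (Sup k) - f (Inf k))) \<le> (\<Sum>k\<in>D. (\<bar>B\<bar> + 1) * (Sup k - Inf k))"
    proof (rule sum_mono)
      fix k assume "k \<in> D"
      note k = division_interval_bounds[OF D(1,2) this]
      have "norm (f (Sup k) - f (Inf k)) \<le> B * (Sup k - Inf k)" using lip[OF k(1,2)] k(3) by simp
      also have "\<dots> \<le> (\<bar>B\<bar> + 1) * (Sup k - Inf k)" by (rule mult_right_mono) (use k(3) in auto)
      finally show "norm (f (Sup k) - f (Inf k)) \<le> (\<bar>B\<bar> + 1) * (Sup k - Inf k)" .
    qed
    also have "\<dots> = (\<bar>B\<bar> + 1) * (\<Sum>k\<in>D. Sup k - Inf k)" by (simp add: sum_distrib_left)
    also have "\<dots> < (\<bar>B\<bar> + 1) * (e / (\<bar>B\<bar> + 1))"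
      by (rule mult_strict_left_mono[OF D(3)]) linarith
    also have "\<dots> = e" by simp
    finally show "(\<Sum>k\<in>D. norm (f (Sup k) - f (Inf k))) < e" .
  qed (use \<open>e > 0\<close> in auto)
qed

text \<open>A continuous derivative on a compact interval is bounded, so the mean value inequality
  makes \<open>f\<close> Lipschitz.\<close>

lemma absolutely_continuous_on_C1:
  fixes f :: "real \<Rightarrow> complex"
  assumes der: "\<And>x. x \<in> {a..b} \<Longrightarrow> (f has_vector_derivative f' x) (at x within {a..b})"
    and cont: "continuous_on {a..b} f'"
  shows "absolutely_continuous_on {a..b} f"
proof -
  have "bounded (f' ` {a..b})" by (rule compact_imp_bounded) (simp add: compact_continuous_image cont)
  then obtain B where B: "\<And>x. x \<in> {a..b} \<Longrightarrow> norm (f' x) \<le> B" unfolding bounded_iff by blast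
  show ?thesis
  proof (rule absolutely_continuous_on_lipschitz)
    fix x y assume "x \<in> {a..b}" "y \<in> {a..b}"
    then show "norm (f x - f y) \<le> B * \<bar>x - y\<bar>"
      using differentiable_bound[of "{a..b}" f "\<lambda>x h. h *\<^sub>R f' x" B x y] der B
      by (simp add: has_vector_derivative_def onorm_scaleR_left bounded_linear_ident onorm_id)
  qed
qed

text \<open>The common source of closure under sums, differences and products: domination of
  increments passes to the sums over a division.\<close>

lemma absolutely_continuous_on_dominated:
  fixes f g h :: "real \<Rightarrow> complex"
  assumes f: "absolutely_continuous_on {a..b} f" and g: "absolutely_continuous_on {a..b} g"
    and h: "\<And>x y. \<lbrakk>x \<in> {a..b}; y \<in> {a..b}\<rbrakk> \<Longrightarrow>
      norm (h x - h y) \<le> B * (norm (f x - f y) + norm (g x - g y))"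
  shows "absolutely_continuous_on {a..b} h"
  unfolding absolutely_continuous_on_def
proof (intro allI impI)
  fix e :: real assume "e > 0"
  define C where "C = \<bar>B\<bar> + 1"
  have C: "C > 0" "B \<le> C" by (auto simp: C_def)
  then have e': "e / (2 * C) > 0" using \<open>e > 0\<close> by simp
  obtain d1 where "d1 > 0" and d1: "\<And>D T. D division_of T \<Longrightarrow> T \<subseteq> {a..b} \<Longrightarrow>
      (\<Sum>k\<in>D. Sup k - Inf k) < d1 \<Longrightarrow> (\<Sum>k\<in>D. norm (f (Sup k) - f (Inf k))) < e / (2 * C)"
    using f[unfolded absolutely_continuous_on_def, rule_format, OF e'] by blast
  obtain d2 where "d2 > 0" and d2: "\<And>D T. D division_of T \<Longrightarrow> T \<subseteq> {a..b} \<Longrightarrow>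
      (\<Sum>k\<in>D. Sup k - Inf k) < d2 \<Longrightarrow> (\<Sum>k\<in>D. norm (g (Sup k) - g (Inf k))) < e / (2 * C)"
    using g[unfolded absolutely_continuous_on_def, rule_format, OF e'] by blast
  show "\<exists>\<delta>>0. \<forall>D T. D division_of T \<and> T \<subseteq> {a..b} \<and> (\<Sum>k\<in>D. Sup k - Inf k) < \<delta> \<longrightarrow>
      (\<Sum>k\<in>D. norm (h (Sup k) - h (Inf k))) < e"
  proof (intro exI[of _ "min d1 d2"] conjI allI impI; (elim conjE)?)
    fix D T assume D: "D division_of T" "T \<subseteq> {a..b}" "(\<Sum>k\<in>D. Sup k - Inf k) < min d1 d2"
    have "(\<Sum>k\<in>D. norm (h (Sup k) - h (Inf k)))
        \<le> (\<Sum>k\<in>D. C * (norm (f (Sup k) - f (Inf k)) + norm (g (Sup k) - g (Inf k))))"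
    proof (rule sum_mono)
      fix k assume "k \<in> D"
      note k = division_interval_bounds[OF D(1,2) this]
      show "norm (h (Sup k) - h (Inf k))
          \<le> C * (norm (f (Sup k) - f (Inf k)) + norm (g (Sup k) - g (Inf k)))"
        by (rule order_trans[OF h[OF k(1,2)]]) (rule mult_right_mono[OF C(2)], simp)
    qed
    also have "\<dots> = C * ((\<Sum>k\<in>D. norm (f (Sup k) - f (Inf k))) + (\<Sum>k\<in>D. norm (g (Sup k) - g (Inf k))))"
      by (simp add: sum_distrib_left sum.distrib distrib_left)
    also have "\<dots> < C * (e / (2 * C) + e / (2 * C))"
      using D C d1[OF D(1,2)] d2[OF D(1,2)] by (intro mult_strict_left_mono add_strict_mono) auto
    also have "\<dots> = e" using C by (simp add: field_simps)
    finally show "(\<Sum>k\<in>D. norm (h (Sup k) - h (Inf k))) < e" .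
  qed (use \<open>d1 > 0\<close> \<open>d2 > 0\<close> in auto)
qed

lemma absolutely_continuous_on_add:
  assumes "absolutely_continuous_on {a..b} f" "absolutely_continuous_on {a..b} g"
  shows "absolutely_continuous_on {a..b} (\<lambda>x. f x + g x)"
  by (rule absolutely_continuous_on_dominated[OF assms, of _ 1])
    (simp add: add_diff_add norm_triangle_ineq)

lemma absolutely_continuous_on_diff:
  assumes "absolutely_continuous_on {a..b} f" "absolutely_continuous_on {a..b} g"
  shows "absolutely_continuous_on {a..b} (\<lambda>x. f x - g x)"
  by (rule absolutely_continuous_on_dominated[OF assms, of _ 1])
    (simp, metis norm_triangle_ineq4 diff_diff_eq2 add_diff_eq diff_add_eq diff_diff_add add.commute)

lemma absolutely_continuous_on_mult:
  assumes f: "absolutely_continuous_on {a..b} f" and g: "absolutely_continuous_on {a..b} g"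
  shows "absolutely_continuous_on {a..b} (\<lambda>x. f x * g x)"
proof -
  have "bounded (f ` {a..b})" "bounded (g ` {a..b})"
    by (intro compact_imp_bounded compact_continuous_image absolutely_continuous_on_imp_continuous_on
        f g compact_Icc)+
  then obtain B C where B: "\<And>x. x \<in> {a..b} \<Longrightarrow> norm (f x) \<le> B"
    and C: "\<And>x. x \<in> {a..b} \<Longrightarrow> norm (g x) \<le> C" unfolding bounded_iff by blast
  show ?thesis
  proof (rule absolutely_continuous_on_dominated[OF f g])
    fix x y assume xy: "x \<in> {a..b}" "y \<in> {a..b}"
    \<comment> \<open>The product rule for increments: each increment comes with a factor that is
      bounded on the compact interval.\<close>
    have "f x * g x - f y * g y = f x * (g x - g y) + g y * (f x - f y)" by (simp add: algebra_simps)
    then have "norm (f x * g x - f y * g y) \<le> norm (f x) * norm (g x - g y) + norm (g y) * norm (f x - f y)"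
      by (metis norm_mult norm_triangle_ineq)
    also have "\<dots> \<le> max B C * norm (g x - g y) + max B C * norm (f x - f y)"
      using B[OF xy(1)] C[OF xy(2)] by (intro add_mono mult_right_mono) auto
    finally show "norm (f x * g x - f y * g y) \<le> max B C * (norm (f x - f y) + norm (g x - g y))"
      by (simp add: algebra_simps)
  qed
qed

section \<open>Growth of solutions and the Wronskian\<close>

context
  fixes q y z
  assumes sol: "SL_solution q z y"
begin

lemma SL_solution_deriv:
  "x \<in> {0..pi} \<Longrightarrow> (y has_vector_derivative ddx y x) (at x within {0..pi})"
  using sol unfolding SL_solution_def ddx_def differentiable_on_def
  by (auto simp: vector_derivative_works)

lemma SL_solution_ddx_AC: "absolutely_continuous_on {0..pi} (ddx y)"
  using sol unfolding SL_solution_def by blast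

lemma SL_solution_AC: "absolutely_continuous_on {0..pi} y"
  by (rule absolutely_continuous_on_C1[OF SL_solution_deriv
        absolutely_continuous_on_imp_continuous_on[OF SL_solution_ddx_AC]])

text \<open>The almost everywhere equation is recast as an explicit null set and solved for the
  second derivative, the form in which the fundamental theorem of calculus takes it.\<close>

lemma SL_solution_ode:
  obtains N where "negligible N"
    "\<And>x. x \<in> {0..pi} - N \<Longrightarrow> (ddx y has_vector_derivative (q x - z) * y x) (at x within {0..pi})"
proof -
  have "AE x in lebesgue. x \<in> {0..pi} \<longrightarrow>
        (\<exists>y''. (ddx y has_vector_derivative y'') (at x within {0..pi}) \<and> - y'' + q x * y x = z * y x)"
    using sol unfolding SL_solution_def by blast
  then obtain N where N: "N \<in> null_sets lebesgue" and
    sub: "{x \<in> space lebesgue. \<not> (x \<in> {0..pi} \<longrightarrow>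
      (\<exists>y''. (ddx y has_vector_derivative y'') (at x within {0..pi}) \<and> - y'' + q x * y x = z * y x))} \<subseteq> N"
    unfolding eventually_ae_filter by auto
  show thesis
  proof
    show "negligible N" using N by (simp add: negligible_iff_null_sets)
    fix x assume x: "x \<in> {0..pi} - N"
    then obtain y'' where y'': "(ddx y has_vector_derivative y'') (at x within {0..pi})"
      "- y'' + q x * y x = z * y x" using sub by auto
    have "y'' = (q x - z) * y x" using y''(2) by (simp add: algebra_simps)
    then show "(ddx y has_vector_derivative (q x - z) * y x) (at x within {0..pi})" using y''(1) by simp
  qed
qed

end

text \<open>For a square root \<open>c\<close> of \<open>-z\<close>, the function \<open>w = y' + c y\<close> solves \<open>w' = c w + q y\<close>,
  so \<open>exp (- c t) w\<close> has derivative \<open>exp (- c t) q y\<close>.\<close>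

lemma SL_solution_factor_bound:
  assumes sol: "SL_solution q z y" and c: "c\<^sup>2 = - z" "\<bar>Re c\<bar> \<le> \<tau>"
    and r: "0 \<le> r" "r \<le> x" "x \<le> pi"
    and q: "(\<lambda>t. norm (q t)) integrable_on {0..pi}"
    and M: "M \<ge> 0" "\<And>t. t \<in> {r..x} \<Longrightarrow> norm (y t) \<le> M * exp (\<tau> * (t - r))"
  shows "norm (ddx y x + c * y x)
      \<le> exp (\<tau> * (x - r)) * (norm (ddx y r + c * y r) + M * integral {0..pi} (\<lambda>t. norm (q t)))"
proof -
  \<comment> \<open>The integrating factor, normalised to be 1 at \<open>x\<close>, so that
    \<open>F x\<close> is the quantity to be bounded.\<close>
  define E where "E t = exp (c * of_real (x - t))" for t :: real
  define F where "F t = E t * (ddx y t + c * y t)" for t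
  obtain N where N: "negligible N" and ode: "\<And>x. x \<in> {0..pi} - N \<Longrightarrow>
      (ddx y has_vector_derivative (q x - z) * y x) (at x within {0..pi})"
    using SL_solution_ode[OF sol] by blast
  have E': "(E has_vector_derivative - c * E t) (at t within {0..pi})" for t
  proof -
    have "((\<lambda>w. exp (c * (of_real x - w))) has_field_derivative - c * E t) (at (of_real t))"
      unfolding E_def by (auto intro!: derivative_eq_intros)
    then show ?thesis
      using has_vector_derivative_real_field unfolding E_def by fastforce
  qed
  have contE: "continuous_on {0..pi} E" unfolding E_def by (intro continuous_intros)
  have normE: "norm (E t) \<le> exp (\<tau> * (x - t))" if "t \<le> x" for t
  proof -
    have "norm (E t) = exp (Re c * (x - t))" by (simp add: E_def)
    also have "\<dots> \<le> exp (\<tau> * (x - t))" using c(2) that by (simp add: mult_right_mono)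
    finally show ?thesis .
  qed
  have ACE: "absolutely_continuous_on {0..pi} E"
    by (rule absolutely_continuous_on_C1[OF E']) (intro continuous_intros contE)
  have ACc: "absolutely_continuous_on {0..pi} (\<lambda>t. c)"
    by (rule absolutely_continuous_on_lipschitz[of _ _ _ 0]) simp
  have ACF: "absolutely_continuous_on {0..pi} F"
    unfolding F_def
    by (intro absolutely_continuous_on_mult absolutely_continuous_on_add ACE ACc
        SL_solution_ddx_AC[OF sol] SL_solution_AC[OF sol])
  have sub: "{r..x} \<subseteq> {0..pi}" using r by auto
  have F': "(F has_vector_derivative E t * (q t * y t)) (at t within {0..pi})" if "t \<in> {0..pi} - N" for t
  proof -
    have "((\<lambda>t. ddx y t + c * y t) has_vector_derivative (q t - z) * y t + c * ddx y t) (at t within {0..pi})"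
      using that by (intro has_vector_derivative_add ode has_vector_derivative_mult_right SL_solution_deriv[OF sol]) auto
    then have "(F has_vector_derivative E t * ((q t - z) * y t + c * ddx y t) + - c * E t * (ddx y t + c * y t))
        (at t within {0..pi})"
      unfolding F_def by (rule has_vector_derivative_mult[OF E'])
    \<comment> \<open>The terms with \<open>c * ddx y t\<close> cancel, and
      \<open>c\<^sup>2 = - z\<close> removes all that does not contain \<open>q\<close>.\<close>
    moreover have "E t * ((q t - z) * y t + c * ddx y t) + - c * E t * (ddx y t + c * y t)
        = E t * (q t * y t) - E t * y t * (z + c\<^sup>2)"
      by (simp add: algebra_simps power2_eq_square)
    ultimately show ?thesis by (simp add: c(1))
  qed
  have int: "((\<lambda>t. E t * (q t * y t)) has_integral F x - F r) {r..x}"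
  proof (rule has_integral_absolutely_continuous_on[OF r(2) absolutely_continuous_on_subset[OF ACF sub] N])
    fix t assume "t \<in> {r..x} - N"
    then show "(F has_vector_derivative E t * (q t * y t)) (at t within {r..x})"
      using F' sub by (intro has_vector_derivative_within_subset[OF F' sub]) auto
  qed
  have qr: "(\<lambda>t. norm (q t)) integrable_on {r..x}" using integrable_on_subinterval[OF q sub] .
  have "norm (F x - F r) = norm (integral {r..x} (\<lambda>t. E t * (q t * y t)))"
    using int by (simp add: integral_unique)
  also have "\<dots> \<le> integral {r..x} (\<lambda>t. exp (\<tau> * (x - r)) * M * norm (q t))"
  proof (rule integral_norm_bound_integral)
    show "(\<lambda>t. E t * (q t * y t)) integrable_on {r..x}" using int by blast
    show "(\<lambda>t. exp (\<tau> * (x - r)) * M * norm (q t)) integrable_on {r..x}"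
      using integrable_on_mult_right[OF qr, of "exp (\<tau> * (x - r)) * M"] by simp
    fix t assume t: "t \<in> {r..x}"
    \<comment> \<open>The exponentials of the integrating factor and of the assumed growth multiply
      to \<open>exp (\<tau> * (x - r))\<close>, independent of \<open>t\<close>, so only the norm of
      \<open>q\<close> is left to integrate.\<close>
    have "norm (E t * (q t * y t)) \<le> exp (\<tau> * (x - t)) * (norm (q t) * (M * exp (\<tau> * (t - r))))"
      unfolding norm_mult using normE[of t] M(2)[OF t] t
      by (intro mult_mono) auto
    also have "\<dots> = exp (\<tau> * (x - r)) * M * norm (q t)"
      by (simp add: algebra_simps flip: exp_add)
    finally show "norm (E t * (q t * y t)) \<le> exp (\<tau> * (x - r)) * M * norm (q t)" .
  qed
  also have "\<dots> = exp (\<tau> * (x - r)) * M * integral {r..x} (\<lambda>t. norm (q t))" by simp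
  also have "\<dots> \<le> exp (\<tau> * (x - r)) * M * integral {0..pi} (\<lambda>t. norm (q t))"
    using M(1) by (intro mult_left_mono integral_subset_le sub qr q) auto
  finally have "norm (F x - F r) \<le> exp (\<tau> * (x - r)) * M * integral {0..pi} (\<lambda>t. norm (q t))" .
  moreover have "norm (F r) \<le> exp (\<tau> * (x - r)) * norm (ddx y r + c * y r)"
    unfolding F_def norm_mult using normE[OF r(2)] by (intro mult_right_mono) auto
  moreover have "norm (F x) \<le> norm (F x - F r) + norm (F r)" by (metis norm_triangle_sub add.commute)
  moreover have "F x = ddx y x + c * y x" by (simp add: F_def E_def)
  ultimately show ?thesis by (simp add: algebra_simps)
qed

text \<open>After division by the expected exponential, the modulus of \<open>y\<close> attains a
  maximum \<open>M\<close> on \<open>{r..x}\<close>. The bounds for \<open>y' + c y\<close> with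
  both square roots \<open>c\<close> of \<open>-z\<close> give an inequality for \<open>M\<close> in
  which the contribution of \<open>q\<close> is small against \<open>norm k\<close>, so
  \<open>M\<close> can be solved for.\<close>

lemma SL_solution_bound:
  assumes sol: "SL_solution q z y" and k: "k\<^sup>2 = z" "0 \<le> Im k" "k \<noteq> 0"
    and Q: "2 * integral {0..pi} (\<lambda>t. norm (q t)) \<le> norm k"
    and q: "(\<lambda>t. norm (q t)) integrable_on {0..pi}"
    and r: "0 \<le> r" "r \<le> x" "x \<le> pi"
  shows "norm (y x) \<le> 2 * (norm (y r) + norm (ddx y r) / norm k) * exp (Im k * (x - r))"
proof -
  define \<tau> where "\<tau> = Im k"
  define I where "I = integral {0..pi} (\<lambda>t. norm (q t))"
  define g where "g t = norm (y t) * exp (- \<tau> * (t - r))" for t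
  have "continuous_on {r..x} y"
    using absolutely_continuous_on_imp_continuous_on[OF SL_solution_AC[OF sol]] r
    by (auto intro: continuous_on_subset)
  then have "continuous_on {r..x} g" unfolding g_def by (intro continuous_intros)
  then obtain s where s: "s \<in> {r..x}" and max: "\<And>t. t \<in> {r..x} \<Longrightarrow> g t \<le> g s"
    using continuous_attains_sup[of "{r..x}" g] r by auto
  define M where "M = g s"
  have yg: "norm (y t) = g t * exp (\<tau> * (t - r))" for t
    by (simp add: g_def flip: exp_add)
  have M0: "M \<ge> 0" by (simp add: M_def g_def)
  have yM: "norm (y t) \<le> M * exp (\<tau> * (t - r))" if "t \<in> {r..x}" for t
    using max[OF that] by (simp add: yg M_def)
  define P where "P = norm (ddx y r) + norm k * norm (y r)"
  have fac: "norm (ddx y s + c * y s) \<le> exp (\<tau> * (s - r)) * (P + M * I)"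
    if c: "c = \<i> * k \<or> c = - (\<i> * k)" for c
  proof -
    have c2: "c\<^sup>2 = - z" "\<bar>Re c\<bar> \<le> \<tau>" "norm c = norm k"
      using c k by (auto simp: power_mult_distrib \<tau>_def norm_mult)
    have "norm (ddx y s + c * y s) \<le> exp (\<tau> * (s - r)) * (norm (ddx y r + c * y r) + M * I)"
      unfolding I_def
      by (rule SL_solution_factor_bound[OF sol c2(1,2) r(1) _ _ q M0]) (use s r yM in auto)
    also have "\<dots> \<le> exp (\<tau> * (s - r)) * (P + M * I)"
      unfolding P_def c2(3)[symmetric] by (simp flip: norm_mult add: norm_triangle_ineq)
    finally show ?thesis .
  qed
  \<comment> \<open>The difference of the two first-order expressions eliminates
    \<open>ddx y s\<close>.\<close>
  have "2 * (\<i> * k) * y s = (ddx y s + (\<i> * k) * y s) - (ddx y s + (- (\<i> * k)) * y s)"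
    by (simp add: algebra_simps)
  then have "norm (2 * (\<i> * k) * y s) \<le> exp (\<tau> * (s - r)) * (P + M * I) + exp (\<tau> * (s - r)) * (P + M * I)"
    using fac[of "\<i> * k"] fac[of "- (\<i> * k)"] by (metis add_mono norm_triangle_le_diff)
  then have "norm k * (M * exp (\<tau> * (s - r))) \<le> exp (\<tau> * (s - r)) * (P + M * I)"
    by (simp add: norm_mult yg M_def)
  then have "norm k * M \<le> P + M * I" by (simp add: mult.left_commute mult.commute)
  \<comment> \<open>By the assumption \<open>Q\<close>, the term with \<open>M\<close> on the right
    is at most half of the left side and is absorbed.\<close>
  moreover have "M * I \<le> M * (norm k / 2)"
    using Q M0 unfolding I_def by (intro mult_left_mono) auto
  ultimately have "norm k * M \<le> 2 * P" by (simp add: algebra_simps)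
  then have "M \<le> 2 * P / norm k" using k(3) by (simp add: field_simps)
  also have "\<dots> = 2 * (norm (y r) + norm (ddx y r) / norm k)" using k(3) by (simp add: P_def field_simps)
  finally have "M \<le> 2 * (norm (y r) + norm (ddx y r) / norm k)" .
  then have "M * exp (\<tau> * (x - r)) \<le> 2 * (norm (y r) + norm (ddx y r) / norm k) * exp (\<tau> * (x - r))"
    by (rule mult_right_mono) simp
  with yM[of x] r show ?thesis by (auto simp: \<tau>_def intro: order_trans)
qed

section \<open>The Wronskian identity\<close>

text \<open>In the derivative of the Wronskian, the products of first derivatives and the terms with
  \<open>z\<close> cancel. The two equations hold off different null sets, whose union is the
  exceptional set.\<close>

lemma has_integral_wronskian:
  assumes y: "SL_solution q z y" and yt: "SL_solution qt z yt" and r: "0 \<le> r" "r \<le> x" "x \<le> pi"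
  shows "((\<lambda>t. (qt t - q t) * (y t * yt t)) has_integral
      (y x * ddx yt x - ddx y x * yt x) - (y r * ddx yt r - ddx y r * yt r)) {r..x}"
proof -
  obtain N where N: "negligible N" and ode: "\<And>x. x \<in> {0..pi} - N \<Longrightarrow>
      (ddx y has_vector_derivative (q x - z) * y x) (at x within {0..pi})"
    using SL_solution_ode[OF y] by blast
  obtain Nt where Nt: "negligible Nt" and odet: "\<And>x. x \<in> {0..pi} - Nt \<Longrightarrow>
      (ddx yt has_vector_derivative (qt x - z) * yt x) (at x within {0..pi})"
    using SL_solution_ode[OF yt] by blast
  have sub: "{r..x} \<subseteq> {0..pi}" using r by auto
  have "absolutely_continuous_on {0..pi} (\<lambda>t. y t * ddx yt t - ddx y t * yt t)"
    by (intro absolutely_continuous_on_mult absolutely_continuous_on_diff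
        SL_solution_ddx_AC[OF y] SL_solution_AC[OF y] SL_solution_ddx_AC[OF yt] SL_solution_AC[OF yt])
  then have AC: "absolutely_continuous_on {r..x} (\<lambda>t. y t * ddx yt t - ddx y t * yt t)"
    using sub by (rule absolutely_continuous_on_subset)
  show ?thesis
  proof (rule has_integral_absolutely_continuous_on[OF r(2) AC negligible_Un[OF N Nt]])
    fix t assume "t \<in> {r..x} - (N \<union> Nt)"
    then have t: "t \<in> {0..pi}" "t \<in> {0..pi} - N" "t \<in> {0..pi} - Nt" using sub by auto
    have "((\<lambda>t. y t * ddx yt t - ddx y t * yt t) has_vector_derivative
        (y t * ((qt t - z) * yt t) + ddx y t * ddx yt t) - (ddx y t * ddx yt t + (q t - z) * y t * yt t))
        (at t within {0..pi})"
      by (intro has_vector_derivative_diff has_vector_derivative_mult ode odet t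
          SL_solution_deriv[OF y] SL_solution_deriv[OF yt])
    then show "((\<lambda>t. y t * ddx yt t - ddx y t * yt t) has_vector_derivative (qt t - q t) * (y t * yt t))
        (at t within {r..x})"
      by (intro has_vector_derivative_within_subset[OF _ sub]) (simp add: algebra_simps)
  qed
qed

section \<open>Flatness of the difference of the potentials\<close>

text \<open>The left derivative sees only points just to the left of \<open>x\<close>, which stay in
  \<open>{a<..x}\<close> because \<open>a < x\<close>; there the induction hypothesis identifies the
  functions to be differentiated.\<close>

lemma left_deriv_eq_nth_deriv_within:
  assumes f: "C_m_on m {a..b} f" and "j \<le> m" "a < x" "x \<le> b"
  shows "left_deriv j f x = nth_deriv_within {a..b} j f x"
  using assms(2-4)
proof (induction j arbitrary: x)
  case (Suc j)
  have at: "at x within {a<..x} = at_left x"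
    by (rule at_within_nhd[of x "{a<..}"]) (use Suc.prems in auto)
  have "nth_deriv_within {a..b} j f differentiable_on {a..b}"
    using f Suc.prems unfolding C_m_on_def by auto
  then have "(nth_deriv_within {a..b} j f has_vector_derivative nth_deriv_within {a..b} (Suc j) f x)
      (at x within {a..b})"
    using Suc.prems unfolding differentiable_on_def by (auto simp: vector_derivative_works)
  then have "(left_deriv j f has_vector_derivative nth_deriv_within {a..b} (Suc j) f x) (at x within {a<..x})"
    by (rule has_vector_derivative_transform[rotated 2, OF has_vector_derivative_within_subset])
      (use Suc in auto)
  then show ?case
    unfolding at by (simp add: vector_derivative_within)
qed simp

text \<open>Taylor's theorem in inequality form: the derivative of order \<open>m\<close> of the
  difference is continuous and vanishes at \<open>b\<close>, so it is at most \<epsilon> near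
  \<open>b\<close>. Each step down in the order of the derivative gains a factor
  \<open>b - x\<close> by the mean value inequality.\<close>

lemma C_m_on_flat_difference:
  assumes f: "C_m_on m {a..b} f" and g: "C_m_on m {a..b} g" and ab: "a < b"
    and eq: "\<And>j. j \<le> m \<Longrightarrow> nth_deriv_within {a..b} j f b = nth_deriv_within {a..b} j g b"
    and "\<epsilon> > 0"
  obtains \<eta> where "0 < \<eta>" "\<And>x. x \<in> {b - \<eta>..b} \<Longrightarrow> norm (f x - g x) \<le> \<epsilon> * (b - x) ^ m"
proof -
  define p where "p j x = nth_deriv_within {a..b} j f x - nth_deriv_within {a..b} j g x" for j x
  have "continuous_on {a..b} (p m)"
    using f g unfolding p_def C_m_on_def by (intro continuous_on_diff) auto
  then obtain d where "d > 0" and d: "\<And>x. \<lbrakk>x \<in> {a..b}; dist x b < d\<rbrakk> \<Longrightarrow> dist (p m x) (p m b) < \<epsilon>"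
    using \<open>\<epsilon> > 0\<close> ab unfolding continuous_on_iff by (metis atLeastAtMost_iff less_eq_real_def)
  \<comment> \<open>Halving \<open>d\<close> gives a strict distance bound on the closed interval;
    \<open>b - a\<close> keeps \<open>{b - \<eta>..b}\<close> inside \<open>{a..b}\<close>.\<close>
  define \<eta> where "\<eta> = min (d / 2) (b - a)"
  have \<eta>: "0 < \<eta>" "\<eta> < d" "\<eta> \<le> b - a" using \<open>d > 0\<close> ab by (auto simp: \<eta>_def)
  have p': "(p j has_vector_derivative p (Suc j) x) (at x within {a..b})" if "j < m" "x \<in> {a..b}" for j x
  proof -
    have "nth_deriv_within {a..b} j h differentiable (at x within {a..b})" if "C_m_on m {a..b} h" for h
      using that \<open>j < m\<close> \<open>x \<in> {a..b}\<close> unfolding C_m_on_def differentiable_on_def by blast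
    then show ?thesis
      unfolding p_def using f g by (intro has_vector_derivative_diff) (auto simp: vector_derivative_works)
  qed
  \<comment> \<open>Descending induction on the order of the derivative: \<open>i\<close> counts the
    steps down from \<open>m\<close>.\<close>
  have "\<forall>x\<in>{b - \<eta>..b}. norm (p (m - i) x) \<le> \<epsilon> * (b - x) ^ i" if "i \<le> m" for i
    using that
  proof (induction i)
    case 0
    have "norm (p m x) \<le> \<epsilon>" if "x \<in> {b - \<eta>..b}" for x
    proof -
      have "dist (p m x) (p m b) < \<epsilon>" using that \<eta> by (intro d) (auto simp: dist_real_def)
      moreover have "p m b = 0" using eq[of m] by (simp add: p_def)
      ultimately show ?thesis by simp
    qed
    then show ?case by simp
  next
    case (Suc i)
    define j where "j = m - Suc i"
    have j: "j < m" "Suc j = m - i" using Suc.prems by (auto simp: j_def)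
    have "norm (p j x) \<le> \<epsilon> * (b - x) ^ Suc i" if x: "x \<in> {b - \<eta>..b}" for x
    proof -
      have sub: "{x..b} \<subseteq> {a..b}" using x \<eta> by auto
      have "norm (p j x - p j b) \<le> \<epsilon> * (b - x) ^ i * norm (x - b)"
      proof (rule differentiable_bound[of "{x..b}" "p j" "\<lambda>t h. h *\<^sub>R p (Suc j) t"])
        fix t assume t: "t \<in> {x..b}"
        show "(p j has_derivative (\<lambda>h. h *\<^sub>R p (Suc j) t)) (at t within {x..b})"
          using has_vector_derivative_within_subset[OF p'[OF j(1)] sub] t sub
          by (auto simp: has_vector_derivative_def)
        have "norm (p (Suc j) t) \<le> \<epsilon> * (b - t) ^ i"
          using Suc t x unfolding j(2) by auto
        also have "\<dots> \<le> \<epsilon> * (b - x) ^ i"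
          using t \<open>\<epsilon> > 0\<close> by (intro mult_left_mono power_mono) auto
        finally show "onorm (\<lambda>h. h *\<^sub>R p (Suc j) t) \<le> \<epsilon> * (b - x) ^ i"
          by (simp add: onorm_scaleR_left bounded_linear_ident onorm_id)
      qed (use x in auto)
      moreover have "p j b = 0" using eq[of j] j by (simp add: p_def)
      ultimately show ?thesis using x by (simp add: mult_ac)
    qed
    then show ?case by (simp add: j_def)
  qed
  from this[of m] have "norm (f x - g x) \<le> \<epsilon> * (b - x) ^ m" if "x \<in> {b - \<eta>..b}" for x
    using that by (simp add: p_def)
  then show thesis using that \<eta>(1) by blast
qed

section \<open>Asymptotics in the sector\<close>

text \<open>A single term of the exponential series is at most the whole sum.\<close>

lemma power_mult_exp_minus_le:
  fixes \<tau> s :: real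
  assumes "\<tau> > 0" "s \<ge> 0"
  shows "s ^ m * exp (- (\<tau> * s)) \<le> fact m / \<tau> ^ m"
proof -
  have "(\<tau> * s) ^ m / fact m \<le> exp (\<tau> * s)"
  proof -
    have "(\<Sum>n\<in>{m}. (\<tau> * s) ^ n /\<^sub>R fact n) \<le> (\<Sum>n. (\<tau> * s) ^ n /\<^sub>R fact n)"
      by (rule sum_le_suminf[OF summable_exp_generic]) (use assms in auto)
    then show ?thesis by (simp add: exp_def divide_inverse mult.commute)
  qed
  then show ?thesis using assms by (simp add: exp_minus field_simps power_mult_distrib)
qed

section \<open>Explicit estimate for the Wronskian\<close>

text \<open>The growth bounds are inserted into the integral of \<open>(qt - q) y yt\<close>. To the
  left of \<open>x - \<eta>\<close> the exponential has lost the factor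
  \<open>exp (- (2 * Im k * \<eta>))\<close>; to the right the difference of the potentials is
  flat.\<close>

lemma wronskian_bound:
  assumes y: "SL_solution q z y" and yt: "SL_solution qt z yt"
    and k: "k\<^sup>2 = z" "0 < Im k"
    and q: "(\<lambda>t. norm (q t)) integrable_on {0..pi}" and qt: "(\<lambda>t. norm (qt t)) integrable_on {0..pi}"
    and Q: "2 * integral {0..pi} (\<lambda>t. norm (q t)) \<le> norm k"
    and Qt: "2 * integral {0..pi} (\<lambda>t. norm (qt t)) \<le> norm k"
    and r: "0 \<le> r" "r \<le> x" "x \<le> pi"
    and p: "\<epsilon> \<ge> 0" "\<And>t. t \<in> {x - \<eta>..x} \<Longrightarrow> norm (q t - qt t) \<le> \<epsilon> * (x - t) ^ m"
  shows "norm ((y x * ddx yt x - ddx y x * yt x) - (y r * ddx yt r - ddx y r * yt r))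
    \<le> 4 * (norm (y r) + norm (ddx y r) / norm k) * (norm (yt r) + norm (ddx yt r) / norm k)
      * exp (2 * Im k * (x - r))
      * (exp (- (2 * Im k * \<eta>)) * (integral {0..pi} (\<lambda>t. norm (q t)) + integral {0..pi} (\<lambda>t. norm (qt t)))
         + \<epsilon> * fact m / Im k ^ Suc m)"
    (is "norm ?W \<le> _")
proof -
  define \<tau> where "\<tau> = Im k"
  define A where "A = norm (y r) + norm (ddx y r) / norm k"
  define B where "B = norm (yt r) + norm (ddx yt r) / norm k"
  define C where "C = 4 * A * B * exp (2 * \<tau> * (x - r))"
  have k0: "k \<noteq> 0" "0 \<le> Im k" "\<tau> > 0" using k(2) by (auto simp: \<tau>_def)
  have AB: "A \<ge> 0" "B \<ge> 0" "C \<ge> 0" by (auto simp: A_def B_def C_def)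
  have sub: "{r..x} \<subseteq> {0..pi}" using r by auto
  have qr: "(\<lambda>t. norm (q t)) integrable_on {r..x}" "(\<lambda>t. norm (qt t)) integrable_on {r..x}"
    using q qt sub by (auto intro: integrable_on_subinterval)
  note W = has_integral_wronskian[OF y yt r]
  \<comment> \<open>The majorant is the sum of the far and the near estimate, so one integrable
    function serves on the whole interval and the integral need not be split.\<close>
  define G where "G t = C * (exp (- (2 * \<tau> * \<eta>)) * (norm (q t) + norm (qt t))
      + \<epsilon> * (fact m / \<tau> ^ m) * exp (\<tau> * (t - x)))" for t
  have expint: "((\<lambda>t. exp (\<tau> * (t - x))) has_integral (1 - exp (\<tau> * (r - x))) / \<tau>) {r..x}"
  proof -
    have "((\<lambda>t. exp (\<tau> * (t - x))) has_integral exp (\<tau> * (x - x)) / \<tau> - exp (\<tau> * (r - x)) / \<tau>) {r..x}"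
      by (rule fundamental_theorem_of_calculus[OF r(2)])
        (use k0 in \<open>auto intro!: derivative_eq_intros simp flip: has_real_derivative_iff_has_vector_derivative\<close>)
    then show ?thesis by (simp add: diff_divide_distrib)
  qed
  have Gint: "(G has_integral C * (exp (- (2 * \<tau> * \<eta>)) *
       (integral {r..x} (\<lambda>t. norm (q t)) + integral {r..x} (\<lambda>t. norm (qt t)))
      + \<epsilon> * (fact m / \<tau> ^ m) * ((1 - exp (\<tau> * (r - x))) / \<tau>))) {r..x}"
    unfolding G_def
    by (intro has_integral_mult_right has_integral_add integrable_integral qr expint)
  have "norm ?W = norm (integral {r..x} (\<lambda>t. (qt t - q t) * (y t * yt t)))"
    using W by (simp add: integral_unique)
  also have "\<dots> \<le> integral {r..x} G"
  proof (rule integral_norm_bound_integral)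
    show "(\<lambda>t. (qt t - q t) * (y t * yt t)) integrable_on {r..x}" "G integrable_on {r..x}"
      using W Gint by blast+
    fix t assume t: "t \<in> {r..x}"
    have b: "norm (y t) \<le> 2 * A * exp (\<tau> * (t - r))" "norm (yt t) \<le> 2 * B * exp (\<tau> * (t - r))"
      unfolding A_def B_def \<tau>_def
      by (rule SL_solution_bound[OF y k(1) k0(2,1) Q q] SL_solution_bound[OF yt k(1) k0(2,1) Qt qt];
          use t r in simp)+
    have "norm ((qt t - q t) * (y t * yt t))
        \<le> norm (q t - qt t) * ((2 * A * exp (\<tau> * (t - r))) * (2 * B * exp (\<tau> * (t - r))))"
      unfolding norm_mult norm_minus_commute[of "qt t"] using b AB
      by (intro mult_left_mono mult_mono) auto
    also have "\<dots> = C * (norm (q t - qt t) * exp (2 * \<tau> * (t - x)))"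
      by (simp add: C_def algebra_simps flip: exp_add)
    also have "norm (q t - qt t) * exp (2 * \<tau> * (t - x))
        \<le> exp (- (2 * \<tau> * \<eta>)) * (norm (q t) + norm (qt t)) + \<epsilon> * (fact m / \<tau> ^ m) * exp (\<tau> * (t - x))"
    proof (cases "t \<le> x - \<eta>")
      case True
      have "\<tau> * t \<le> \<tau> * (x - \<eta>)" using True k0 by simp
      then have "exp (2 * \<tau> * (t - x)) \<le> exp (- (2 * \<tau> * \<eta>))" by (simp add: algebra_simps)
      then have "norm (q t - qt t) * exp (2 * \<tau> * (t - x)) \<le> (norm (q t) + norm (qt t)) * exp (- (2 * \<tau> * \<eta>))"
        by (intro mult_mono norm_triangle_ineq4) auto
      moreover have "0 \<le> \<epsilon> * (fact m / \<tau> ^ m) * exp (\<tau> * (t - x))" using p(1) k0 by simp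
      ultimately show ?thesis by (simp add: mult.commute)
    next
      case False
      have "norm (q t - qt t) * exp (2 * \<tau> * (t - x)) \<le> \<epsilon> * (x - t) ^ m * exp (2 * \<tau> * (t - x))"
        using p(2)[of t] False t by (intro mult_right_mono) auto
      \<comment> \<open>The decaying exponential is halved: one half absorbs
        \<open>(x - t) ^ m\<close> at the cost of \<open>fact m / \<tau> ^ m\<close>, the other is
        integrated and yields the last factor \<open>1 / \<tau>\<close>.\<close>
      also have "\<dots> = \<epsilon> * ((x - t) ^ m * exp (- (\<tau> * (x - t)))) * exp (\<tau> * (t - x))"
        by (simp add: algebra_simps flip: exp_add)
      also have "\<dots> \<le> \<epsilon> * (fact m / \<tau> ^ m) * exp (\<tau> * (t - x))"
        using power_mult_exp_minus_le[OF k0(3), of "x - t" m] t p(1)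
        by (intro mult_right_mono mult_left_mono) auto
      finally show ?thesis by (simp add: add_increasing)
    qed
    finally show "norm ((qt t - q t) * (y t * yt t)) \<le> G t"
      using AB(3) unfolding G_def by (simp add: mult_left_mono)
  qed
  also have "\<dots> = C * (exp (- (2 * \<tau> * \<eta>)) *
       (integral {r..x} (\<lambda>t. norm (q t)) + integral {r..x} (\<lambda>t. norm (qt t)))
      + \<epsilon> * (fact m / \<tau> ^ m) * ((1 - exp (\<tau> * (r - x))) / \<tau>))"
    using Gint by (rule integral_unique)
  also have "\<dots> \<le> C * (exp (- (2 * \<tau> * \<eta>)) *
       (integral {0..pi} (\<lambda>t. norm (q t)) + integral {0..pi} (\<lambda>t. norm (qt t)))
      + \<epsilon> * (fact m / \<tau> ^ m) * (1 / \<tau>))"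
    using AB(3) p(1) k0(3)
    by (intro mult_left_mono add_mono integral_subset_le sub qr q qt divide_right_mono) auto
  also have "\<epsilon> * (fact m / \<tau> ^ m) * (1 / \<tau>) = \<epsilon> * fact m / \<tau> ^ Suc m" by simp
  finally show ?thesis unfolding C_def A_def B_def \<tau>_def .
qed

section \<open>From the explicit estimate to little-o\<close>

text \<open>The argument of \<open>csqrt z\<close> is \<open>Arg z / 2\<close>, which exceeds
  \<open>\<zeta> / 2\<close> and stays below \<open>pi / 2\<close>, where the sine increases; hence
  the constant \<open>sin (\<zeta> / 2)\<close>.\<close>

lemma Im_csqrt_sector:
  assumes "\<zeta> > 0"
  obtains \<sigma> where "\<sigma> > 0" "\<And>z. z \<in> sector \<zeta> \<Longrightarrow> \<sigma> * norm (csqrt z) \<le> Im (csqrt z)"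
proof (cases "\<zeta> < pi / 2")
  case True
  show thesis
  proof
    show "sin (\<zeta> / 2) > 0" using assms True by (intro sin_gt_zero) auto
    fix z assume "z \<in> sector \<zeta>"
    then have A: "\<zeta> < Arg z" "Arg z < pi - \<zeta>" by (auto simp: sector_def)
    then have "z \<noteq> 0" using assms by (auto simp: Arg_zero)
    then have c: "csqrt z = exp (Ln z / 2)" by (rule csqrt_exp_Ln)
    have "Im (csqrt z) = norm (csqrt z) * sin (Arg z / 2)"
      unfolding c using \<open>z \<noteq> 0\<close> by (simp add: Im_exp Arg_eq_Im_Ln)
    moreover have "sin (\<zeta> / 2) \<le> sin (Arg z / 2)"
      using A assms by (intro sin_monotone_2pi_le) auto
    ultimately show "sin (\<zeta> / 2) * norm (csqrt z) \<le> Im (csqrt z)"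
      by (simp add: mult.commute mult_left_mono)
  qed
next
  \<comment> \<open>For such large \<zeta> the sector is empty and any positive constant
    serves.\<close>
  case False
  then have "sector \<zeta> = {}" by (auto simp: sector_def)
  then show thesis using that[of 1] by auto
qed

lemma filterlim_norm_csqrt_infinity_in_sector:
  "filterlim (\<lambda>z. norm (csqrt z)) at_top (infinity_in_sector \<zeta>)"
proof -
  have "filterlim (\<lambda>z. sqrt (norm z)) at_top (at_infinity :: complex filter)"
    by (rule filterlim_compose[OF sqrt_at_top filterlim_norm_at_top])
  then have "filterlim (\<lambda>z. norm (csqrt z)) at_top (at_infinity :: complex filter)" by simp
  then show ?thesis
    unfolding infinity_in_sector_def by (rule filterlim_mono[OF _ order_refl inf_le1])
qed

lemma eventually_power_mult_exp_minus_le: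
  fixes \<alpha> d C :: real
  assumes "\<alpha> > 0" "d > 0"
  shows "\<forall>\<^sub>F \<kappa> in at_top. C * \<kappa> ^ n * exp (- (\<alpha> * \<kappa>)) \<le> d"
proof -
  have "((\<lambda>\<kappa>. (\<alpha> * \<kappa>) ^ n / exp (\<alpha> * \<kappa>)) \<longlongrightarrow> 0) at_top"
    by (rule filterlim_compose[OF tendsto_power_div_exp_0])
      (use assms in \<open>auto intro: filterlim_tendsto_pos_mult_at_top[OF tendsto_const _ filterlim_ident]\<close>)
  from tendsto_mult_left[OF this, of "C / \<alpha> ^ n"]
  have "((\<lambda>\<kappa>. C / \<alpha> ^ n * ((\<alpha> * \<kappa>) ^ n / exp (\<alpha> * \<kappa>))) \<longlongrightarrow> 0) at_top" by simp
  moreover have "C / \<alpha> ^ n * ((\<alpha> * \<kappa>) ^ n / exp (\<alpha> * \<kappa>)) = C * \<kappa> ^ n * exp (- (\<alpha> * \<kappa>))" for \<kappa>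
    using assms(1) by (simp add: power_mult_distrib exp_minus field_simps)
  ultimately have "((\<lambda>\<kappa>. C * \<kappa> ^ n * exp (- (\<alpha> * \<kappa>))) \<longlongrightarrow> 0) at_top" by simp
  then have "\<forall>\<^sub>F \<kappa> in at_top. C * \<kappa> ^ n * exp (- (\<alpha> * \<kappa>)) < d"
    using assms(2) by (rule order_tendstoD(2))
  then show ?thesis by eventually_elim simp
qed

text \<open>All four asymptotic formulas at once: \<open>i\<close> and \<open>j\<close> are 0 for a
  solution with value 1 and derivative 0 at \<open>r\<close>, and 1 for one with value 0 and
  derivative 1. They record the power of \<open>1 / \<kappa>\<close> that the initial data
  contribute to the growth bound.\<close>

lemma wronskian_smallo:
  fixes y yt :: "complex \<Rightarrow> real \<Rightarrow> complex" and a b a' b' :: complex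
  assumes q: "q absolutely_integrable_on {0..pi}" and qt: "qt absolutely_integrable_on {0..pi}"
    and r: "0 \<le> r" "r < x" "x \<le> pi" and "\<zeta> > 0"
    and y: "\<And>z. SL_solution q z (y z) \<and> y z r = a \<and> ddx (y z) r = b"
    and yt: "\<And>z. SL_solution qt z (yt z) \<and> yt z r = a' \<and> ddx (yt z) r = b'"
    and i: "\<And>\<kappa>. \<kappa> > 0 \<Longrightarrow> norm a + norm b / \<kappa> = 1 / \<kappa> ^ i"
    and j: "\<And>\<kappa>. \<kappa> > 0 \<Longrightarrow> norm a' + norm b' / \<kappa> = 1 / \<kappa> ^ j"
    and flat: "\<And>\<epsilon>. \<epsilon> > 0 \<Longrightarrow> \<exists>\<eta>>0. \<forall>t\<in>{x - \<eta>..x}. norm (q t - qt t) \<le> \<epsilon> * (x - t) ^ m"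
  shows "(\<lambda>z. y z x * ddx (yt z) x - ddx (y z) x * yt z x)
    \<in> o[infinity_in_sector \<zeta>](bound (x - r) (m + 1 + i + j))"
proof (rule landau_o.smallI)
  fix c :: real assume "c > 0"
  define Q where "Q = integral {0..pi} (\<lambda>t. norm (q t))"
  define Qt where "Qt = integral {0..pi} (\<lambda>t. norm (qt t))"
  have qn: "(\<lambda>t. norm (q t)) integrable_on {0..pi}" "(\<lambda>t. norm (qt t)) integrable_on {0..pi}"
    using q qt by (auto simp: absolutely_integrable_on_def)
  have Q0: "Q \<ge> 0" "Qt \<ge> 0" by (simp_all add: Q_def Qt_def integral_nonneg qn)
  obtain \<sigma> where \<sigma>: "\<sigma> > 0" "\<And>z. z \<in> sector \<zeta> \<Longrightarrow> \<sigma> * norm (csqrt z) \<le> Im (csqrt z)"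
    using Im_csqrt_sector[OF \<open>\<zeta> > 0\<close>] by blast
  \<comment> \<open>Chosen so that the near part of the estimate, with \<open>Im k\<close> replaced
    by its lower bound \<open>\<sigma> * \<kappa>\<close>, is exactly one third of the allowed
    error.\<close>
  define \<epsilon> where "\<epsilon> = c * \<sigma> ^ Suc m / (12 * fact m)"
  have \<epsilon>: "\<epsilon> > 0" using \<open>c > 0\<close> \<sigma> by (simp add: \<epsilon>_def)
  obtain \<eta> where \<eta>: "\<eta> > 0" "\<And>t. t \<in> {x - \<eta>..x} \<Longrightarrow> norm (q t - qt t) \<le> \<epsilon> * (x - t) ^ m"
    using flat[OF \<epsilon>] by blast
  define L where "L = x - r"
  define n where "n = m + 1 + i + j"
  \<comment> \<open>The modulus of the Wronskian at \<open>r\<close>. It does not depend on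
    \<open>z\<close>, so it is negligible against the exponential because
    \<open>L > 0\<close>.\<close>
  define w where "w = norm (a * b' - b * a')"
  have "\<forall>\<^sub>F \<kappa> in at_top. w * \<kappa> ^ n * exp (- (2 * \<sigma> * L * \<kappa>)) \<le> c / 3"
    "\<forall>\<^sub>F \<kappa> in at_top. 4 * (Q + Qt) * \<kappa> ^ Suc m * exp (- (2 * \<sigma> * \<eta> * \<kappa>)) \<le> c / 3"
    using \<sigma> \<eta> r \<open>c > 0\<close> by (intro eventually_power_mult_exp_minus_le; simp add: L_def)+
  \<comment> \<open>One third of \<open>c\<close> each for the Wronskian at \<open>r\<close> and for
    the far part; the last condition makes \<kappa> positive and large enough for both growth
    bounds.\<close>
  then have "\<forall>\<^sub>F \<kappa> in at_top. w * \<kappa> ^ n * exp (- (2 * \<sigma> * L * \<kappa>)) \<le> c / 3 \<and>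
      4 * (Q + Qt) * \<kappa> ^ Suc m * exp (- (2 * \<sigma> * \<eta> * \<kappa>)) \<le> c / 3 \<and> \<kappa> \<ge> 2 * Q + 2 * Qt + 1"
    using eventually_ge_at_top by (intro eventually_conj)
  from eventually_compose_filterlim[OF this filterlim_norm_csqrt_infinity_in_sector]
  have large: "\<forall>\<^sub>F z in infinity_in_sector \<zeta>.
      w * norm (csqrt z) ^ n * exp (- (2 * \<sigma> * L * norm (csqrt z))) \<le> c / 3 \<and>
      4 * (Q + Qt) * norm (csqrt z) ^ Suc m * exp (- (2 * \<sigma> * \<eta> * norm (csqrt z))) \<le> c / 3 \<and>
      norm (csqrt z) \<ge> 2 * Q + 2 * Qt + 1" .
  have sect: "\<forall>\<^sub>F z in infinity_in_sector \<zeta>. z \<in> sector \<zeta>"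
    unfolding infinity_in_sector_def eventually_inf_principal by simp
  from large sect
  show "\<forall>\<^sub>F z in infinity_in_sector \<zeta>. norm (y z x * ddx (yt z) x - ddx (y z) x * yt z x)
      \<le> c * norm (bound (x - r) (m + 1 + i + j) z)"
  proof eventually_elim
    fix z
    define k where "k = csqrt z"
    define \<kappa> where "\<kappa> = norm k"
    define \<tau> where "\<tau> = Im k"
    assume "w * norm (csqrt z) ^ n * exp (- (2 * \<sigma> * L * norm (csqrt z))) \<le> c / 3 \<and>
      4 * (Q + Qt) * norm (csqrt z) ^ Suc m * exp (- (2 * \<sigma> * \<eta> * norm (csqrt z))) \<le> c / 3 \<and>
      norm (csqrt z) \<ge> 2 * Q + 2 * Qt + 1" and z: "z \<in> sector \<zeta>"
    then have 1: "w * \<kappa> ^ n * exp (- (2 * \<sigma> * L * \<kappa>)) \<le> c / 3"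
      and 2: "4 * (Q + Qt) * \<kappa> ^ Suc m * exp (- (2 * \<sigma> * \<eta> * \<kappa>)) \<le> c / 3"
      and 3: "\<kappa> \<ge> 2 * Q + 2 * Qt + 1"
      by (simp_all only: \<kappa>_def k_def)
    have \<kappa>: "\<kappa> > 0" "2 * Q \<le> \<kappa>" "2 * Qt \<le> \<kappa>" using 3 Q0 by auto
    have \<sigma>\<kappa>: "0 < \<sigma> * \<kappa>" "\<sigma> * \<kappa> \<le> \<tau>" using \<sigma>(1) \<sigma>(2)[OF z] \<kappa> by (auto simp: \<kappa>_def k_def \<tau>_def)
    then have \<tau>: "\<tau> > 0" by linarith
    define E where "E = exp (2 * \<tau> * L)"
    define W where "W = y z x * ddx (yt z) x - ddx (y z) x * yt z x"
    have L: "L > 0" using r by (simp add: L_def)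
    have "norm (W - (a * b' - b * a')) \<le> 4 * (1 / \<kappa> ^ i) * (1 / \<kappa> ^ j) * E
        * (exp (- (2 * \<tau> * \<eta>)) * (Q + Qt) + \<epsilon> * fact m / \<tau> ^ Suc m)"
      using wronskian_bound[of q z "y z" qt "yt z" k r x \<epsilon> \<eta> m] y[of z] yt[of z] qn \<kappa> \<tau> r \<epsilon> \<eta>(2)
      by (simp add: W_def Q_def Qt_def \<kappa>_def[symmetric] \<tau>_def[symmetric] L_def E_def
          i[OF \<kappa>(1)] j[OF \<kappa>(1)] k_def[THEN arg_cong, of "\<lambda>k. k\<^sup>2"])
    also have "\<dots> = E / \<kappa> ^ (i + j) * (4 * (Q + Qt) * exp (- (2 * \<tau> * \<eta>)) + 4 * \<epsilon> * fact m / \<tau> ^ Suc m)"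
      by (simp add: power_add algebra_simps)
    also have "\<dots> \<le> E / \<kappa> ^ (i + j) * (c / 3 / \<kappa> ^ Suc m + c / 3 / \<kappa> ^ Suc m)"
    proof (intro mult_left_mono add_mono)
      \<comment> \<open>The sector enters here: \<open>\<sigma> * \<kappa> \<le> \<tau>\<close>
        turns decay in the imaginary part into decay in the modulus.\<close>
      have "exp (- (2 * \<tau> * \<eta>)) \<le> exp (- (2 * \<sigma> * \<eta> * \<kappa>))"
        using mult_right_mono[OF \<sigma>\<kappa>(2), of \<eta>] \<eta>(1) by (simp add: mult_ac)
      then have "4 * (Q + Qt) * exp (- (2 * \<tau> * \<eta>)) \<le> 4 * (Q + Qt) * exp (- (2 * \<sigma> * \<eta> * \<kappa>))"
        using Q0 by (intro mult_left_mono) auto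
      also have "\<dots> \<le> c / 3 / \<kappa> ^ Suc m"
        using 2 \<kappa>(1) by (subst pos_le_divide_eq) (auto simp: mult_ac)
      finally show "4 * (Q + Qt) * exp (- (2 * \<tau> * \<eta>)) \<le> c / 3 / \<kappa> ^ Suc m" .
      have "4 * \<epsilon> * fact m / \<tau> ^ Suc m \<le> 4 * \<epsilon> * fact m / (\<sigma> * \<kappa>) ^ Suc m"
        using \<sigma>(1) \<kappa>(1) \<sigma>\<kappa> \<epsilon> \<tau> by (intro divide_left_mono power_mono mult_pos_pos zero_less_power) auto
      also have "\<dots> = c / 3 / \<kappa> ^ Suc m"
        using \<sigma>(1) \<kappa>(1) by (simp add: \<epsilon>_def power_mult_distrib field_simps)
      finally show "4 * \<epsilon> * fact m / \<tau> ^ Suc m \<le> c / 3 / \<kappa> ^ Suc m" .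
    qed (use \<kappa>(1) in \<open>simp add: E_def\<close>)
    also have "\<dots> = 2 * (c / 3) * (E / \<kappa> ^ n)" by (simp add: n_def power_add mult_ac)
    finally have main: "norm (W - (a * b' - b * a')) \<le> 2 * (c / 3) * (E / \<kappa> ^ n)" .
    have "w * \<kappa> ^ n \<le> c / 3 * exp (2 * \<sigma> * L * \<kappa>)"
      using 1 by (simp add: exp_minus field_simps)
    also have "\<dots> \<le> c / 3 * E"
      using mult_right_mono[OF \<sigma>\<kappa>(2), of L] L \<open>c > 0\<close> by (simp add: E_def mult_ac)
    finally have const: "w \<le> c / 3 * (E / \<kappa> ^ n)" using \<kappa>(1) by (simp add: field_simps)
    have "norm W \<le> w + norm (W - (a * b' - b * a'))" unfolding w_def by (rule norm_triangle_sub)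
    also have "\<dots> \<le> c / 3 * (E / \<kappa> ^ n) + 2 * (c / 3) * (E / \<kappa> ^ n)" by (rule add_mono[OF const main])
    also have "\<dots> = c * (E / \<kappa> ^ n)" by (simp add: field_simps)
    finally have "norm W \<le> c * (E / \<kappa> ^ n)" .
    moreover have "norm (bound (x - r) (m + 1 + i + j) z) = E / \<kappa> ^ n"
      using \<tau> unfolding bound_def k_def[symmetric] \<kappa>_def[symmetric] \<tau>_def[symmetric]
      by (simp add: E_def L_def n_def \<kappa>_def norm_divide norm_mult norm_power)
    ultimately show "norm (y z x * ddx (yt z) x - ddx (y z) x * yt z x)
        \<le> c * norm (bound (x - r) (m + 1 + i + j) z)" by (simp add: W_def)
  qed
qed

section \<open>The four asymptotic formulas\<close>

theorem proposition1:
  fixes q qt :: "real \<Rightarrow> complex"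
    and y1 y2 yt1 yt2 :: "complex \<Rightarrow> real \<Rightarrow> complex"
    and r x0 \<delta> \<zeta> :: real
    and m :: nat
  assumes "q absolutely_integrable_on {0..pi}"
    and "qt absolutely_integrable_on {0..pi}"
    and "r \<in> {0..<pi}"
    and "x0 \<in> {r<..pi}"
    and "\<And>z. SL_solution q z (y1 z) \<and> y1 z r = 1 \<and> ddx (y1 z) r = 0"
    and "\<And>z. SL_solution q z (y2 z) \<and> y2 z r = 0 \<and> ddx (y2 z) r = 1"
    and "\<And>z. SL_solution qt z (yt1 z) \<and> yt1 z r = 1 \<and> ddx (yt1 z) r = 0"
    and "\<And>z. SL_solution qt z (yt2 z) \<and> yt2 z r = 0 \<and> ddx (yt2 z) r = 1"
    and "0 < \<delta>" and "\<delta> \<le> x0"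
    and "C_m_on m {x0 - \<delta>..x0} q"
    and "C_m_on m {x0 - \<delta>..x0} qt"
    and "\<And>j. j \<le> m \<Longrightarrow> left_deriv j q x0 = left_deriv j qt x0"
    and "\<zeta> > 0"
  shows "(\<lambda>z. y1 z x0 * ddx (yt1 z) x0 - ddx (y1 z) x0 * yt1 z x0)
           \<in> o[infinity_in_sector \<zeta>](bound (x0 - r) (m + 1))
       \<and> (\<lambda>z. y1 z x0 * ddx (yt2 z) x0 - ddx (y1 z) x0 * yt2 z x0)
           \<in> o[infinity_in_sector \<zeta>](bound (x0 - r) (m + 2))
       \<and> (\<lambda>z. ddx (yt1 z) x0 * y2 z x0 - yt1 z x0 * ddx (y2 z) x0)
           \<in> o[infinity_in_sector \<zeta>](bound (x0 - r) (m + 2))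
       \<and> (\<lambda>z. y2 z x0 * ddx (yt2 z) x0 - ddx (y2 z) x0 * yt2 z x0)
           \<in> o[infinity_in_sector \<zeta>](bound (x0 - r) (m + 3))"
proof -
  have r: "0 \<le> r" "r < x0" "x0 \<le> pi" using assms(3,4) by auto
  \<comment> \<open>The hypothesis compares left derivatives, whereas the flatness estimate uses
    derivatives within the closed interval; they agree at \<open>x0\<close>, which lies to the right
    of \<open>x0 - \<delta>\<close>.\<close>
  have eq: "nth_deriv_within {x0 - \<delta>..x0} j q x0 = nth_deriv_within {x0 - \<delta>..x0} j qt x0"
    if "j \<le> m" for j
    using left_deriv_eq_nth_deriv_within[OF assms(11) that, of x0]
      left_deriv_eq_nth_deriv_within[OF assms(12) that, of x0] assms(13)[OF that] \<open>0 < \<delta>\<close>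
    by simp
  have flat: "\<exists>\<eta>>0. \<forall>t\<in>{x0 - \<eta>..x0}. norm (q t - qt t) \<le> \<epsilon> * (x0 - t) ^ m" if "\<epsilon> > 0" for \<epsilon>
  proof -
    obtain \<eta> where "0 < \<eta>" "\<And>t. t \<in> {x0 - \<eta>..x0} \<Longrightarrow> norm (q t - qt t) \<le> \<epsilon> * (x0 - t) ^ m"
      by (rule C_m_on_flat_difference[OF assms(11,12) _ eq \<open>\<epsilon> > 0\<close>]) (use \<open>0 < \<delta>\<close> in auto)
    then show ?thesis by blast
  qed
  note W = wronskian_smallo[OF assms(1,2) r \<open>\<zeta> > 0\<close> _ _ _ _ flat]
  \<comment> \<open>The exponents are written as \<open>m + 1 + i + j\<close>, so that
    \<open>i\<close> and \<open>j\<close> can be read off by unification.\<close>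
  have "(\<lambda>z. y1 z x0 * ddx (yt1 z) x0 - ddx (y1 z) x0 * yt1 z x0)
      \<in> o[infinity_in_sector \<zeta>](bound (x0 - r) (m + 1 + 0 + 0))"
    by (rule W[OF assms(5,7)]) auto
  moreover have "(\<lambda>z. y1 z x0 * ddx (yt2 z) x0 - ddx (y1 z) x0 * yt2 z x0)
      \<in> o[infinity_in_sector \<zeta>](bound (x0 - r) (m + 1 + 0 + 1))"
    by (rule W[OF assms(5,8)]) auto
  \<comment> \<open>This is the third formula with the factors in Wronskian order; commutativity
    restores the stated one.\<close>
  moreover have "(\<lambda>z. y2 z x0 * ddx (yt1 z) x0 - ddx (y2 z) x0 * yt1 z x0)
      \<in> o[infinity_in_sector \<zeta>](bound (x0 - r) (m + 1 + 1 + 0))"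
    by (rule W[OF assms(6,7)]) auto
  moreover have "(\<lambda>z. y2 z x0 * ddx (yt2 z) x0 - ddx (y2 z) x0 * yt2 z x0)
      \<in> o[infinity_in_sector \<zeta>](bound (x0 - r) (m + 1 + 1 + 1))"
    by (rule W[OF assms(6,8)]) auto
  ultimately show ?thesis by (simp add: mult.commute eval_nat_numeral)
qed

end
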